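(* Let $n$ be a positive integer and let $P_n \,\Box\, P_n$ be the Cartesian product of two $n$-vertex paths. If $n \le 2$, then $c_\infty(P_n \,\Box\, P_n) = n$; if $n$ is odd and at least $3$, then $c_\infty(P_n \,\Box\, P_n) = n-1$; if $n$ is even and at least $4$, then $c_\infty(P_n \,\Box\, P_n) \in \{n-1, n\}$.
   Context: The infinite-speed game of Cops and Robbers on a finite graph $G$: there is a team of cops and one robber, each occupying a vertex of $G$ (several cops may share a vertex), with all positions known to both players. The cops first choose their initial positions; then the robber chooses his initial position. The game proceeds in rounds, each consisting of a cop turn followed by a robber turn. On the cops' turn, each cop either stays at her vertex or moves to a neighboring vertex. On the robber's turn, he may stay put or move along any path in $G$ of arbitrary length starting at his current vertex that does not pass through any vertex occupied by a cop. The cops win if at some point some cop occupies the same vertex as the robber; the robber wins if he evades capture forever. The infinite-speed cop number $c_\infty(G)$ is the minimum number of cops that guarantees a win for the cops on $G$ no matter how the robber plays. $P_n$ denotes the path with $n$ vertices and $\Box$ denotes the Cartesian product of graphs. *)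

theory Defs
  imports "Graph_Theory.Graph_Theory"
begin

text \<open>
  Finite simple graphs are represented as in the library, by symmetric loop-free sets of ordered
  pairs (locale \<^locale>\<open>pair_graph\<close>).
\<close>

definition path_graph :: "nat \<Rightarrow> nat pair_pre_digraph" where
  "path_graph n = \<lparr> pverts = {..<n},
     parcs = {(i, j). i < n \<and> j < n \<and> (j = Suc i \<or> i = Suc j)} \<rparr>"

definition cartesian_prod ::
    "'a pair_pre_digraph \<Rightarrow> 'b pair_pre_digraph \<Rightarrow> ('a \<times> 'b) pair_pre_digraph"
    (infixr "\<box>" 70) where
  "G \<box> H = \<lparr> pverts = pverts G \<times> pverts H,
     parcs = {((a, b), (a', b')).
       a = a' \<and> a \<in> pverts G \<and> (b, b') \<in> parcs H \<or>
       b = b' \<and> b \<in> pverts H \<and> (a, a') \<in> parcs G} \<rparr>"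

lemma pair_graph_path_graph: "pair_graph (path_graph n)"
proof -
  have "finite {(i, j). i < n \<and> j < n \<and> (j = Suc i \<or> i = Suc j)}"
    by (rule finite_subset[of _ "{..<n} \<times> {..<n}"]) auto
  then show ?thesis
    by unfold_locales (auto simp: path_graph_def symmetric_def intro!: symI)
qed

lemma pair_graph_cartesian_prod:
  assumes "pair_graph G" "pair_graph H"
  shows "pair_graph (G \<box> H)"
proof -
  interpret G: pair_graph G by fact
  interpret H: pair_graph H by fact
  have sub: "parcs (G \<box> H) \<subseteq> (pverts G \<times> pverts H) \<times> (pverts G \<times> pverts H)"
    by (auto simp: cartesian_prod_def dest: G.wellformed' H.wellformed')
  have fin: "finite (pverts G)" "finite (pverts H)"
    by (rule G.pair_finite_verts, rule H.pair_finite_verts)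
  have symG: "(b, a) \<in> parcs G" if "(a, b) \<in> parcs G" for a b
    using G.pair_sym_arcs that by (auto simp: symmetric_def dest: symD)
  have symH: "(b, a) \<in> parcs H" if "(a, b) \<in> parcs H" for a b
    using H.pair_sym_arcs that by (auto simp: symmetric_def dest: symD)
  show ?thesis
  proof unfold_locales
    show "finite (pverts (G \<box> H))" using fin by (simp add: cartesian_prod_def)
    show "finite (parcs (G \<box> H))"
      by (rule finite_subset[OF sub]) (use fin in auto)
    show "symmetric (with_proj (G \<box> H))"
      unfolding symmetric_def by (rule symI) (auto simp: cartesian_prod_def dest: symG symH)
  next
    fix e assume "e \<in> parcs (G \<box> H)"
    then show "fst e \<noteq> snd e"
      by (auto simp: cartesian_prod_def dest: G.pair_no_loops H.pair_no_loops)
  qed (auto simp: cartesian_prod_def dest: G.wellformed' H.wellformed')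
qed


text \<open>
  The positions of a team of \<open>k\<close> cops form a list of \<open>k\<close> vertices, not necessarily distinct.
\<close>

definition cop_positions :: "'a pair_pre_digraph \<Rightarrow> nat \<Rightarrow> 'a list set" where
  "cop_positions G k = {c. length c = k \<and> set c \<subseteq> pverts G}"

definition cop_move :: "'a pair_pre_digraph \<Rightarrow> 'a list \<Rightarrow> 'a list \<Rightarrow> bool" where
  "cop_move G c c' \<longleftrightarrow> list_all2 (\<lambda>u v. v = u \<or> (u, v) \<in> parcs G) c c'"

definition robber_move :: "'a pair_pre_digraph \<Rightarrow> 'a list \<Rightarrow> 'a \<Rightarrow> 'a \<Rightarrow> bool" where
  "robber_move G c r r' \<longleftrightarrow>
     r' = r \<or> (\<exists>p. vpath p (with_proj G) \<and> hd p = r \<and> last p = r' \<and> set p \<inter> set c = {})"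

text \<open>
  A history lists the pairs (cops, robber) after the placement and after each completed round.
  A strategy of the cops consists of an initial placement and a function assigning to every
  history the positions of the cops after their next turn.
\<close>

type_synonym 'a history = "('a list \<times> 'a) list"

definition cop_strategy ::
    "'a pair_pre_digraph \<Rightarrow> nat \<Rightarrow> 'a list \<Rightarrow> ('a history \<Rightarrow> 'a list) \<Rightarrow> bool" where
  "cop_strategy G k c0 \<sigma> \<longleftrightarrow> c0 \<in> cop_positions G k \<and>
     (\<forall>h c r. c \<in> cop_positions G k \<and> r \<in> pverts G \<longrightarrow> cop_move G c (\<sigma> (h @ [(c, r)])))"

text \<open>
  \<open>C t\<close> and \<open>R t\<close> are the positions after \<open>t\<close> rounds, so that the robber's turn in round
  \<open>Suc t\<close> is made against the cops at \<open>C (Suc t)\<close>. Plays are continued after a capture, which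
  does not affect who wins.
\<close>

definition play ::
    "'a pair_pre_digraph \<Rightarrow> 'a list \<Rightarrow> ('a history \<Rightarrow> 'a list) \<Rightarrow> (nat \<Rightarrow> 'a list) \<Rightarrow> (nat \<Rightarrow> 'a) \<Rightarrow> bool"
  where
  "play G c0 \<sigma> C R \<longleftrightarrow> C 0 = c0 \<and> R 0 \<in> pverts G \<and>
     (\<forall>t. C (Suc t) = \<sigma> (map (\<lambda>i. (C i, R i)) [0..<Suc t]) \<and>
          robber_move G (C (Suc t)) (R t) (R (Suc t)))"

text \<open>Capture happens either after a turn of the robber (or his placement) or after a cop turn.\<close>

definition captured :: "(nat \<Rightarrow> 'a list) \<Rightarrow> (nat \<Rightarrow> 'a) \<Rightarrow> bool" where
  "captured C R \<longleftrightarrow> (\<exists>t. R t \<in> set (C t) \<or> R t \<in> set (C (Suc t)))"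

definition cops_win :: "'a pair_pre_digraph \<Rightarrow> nat \<Rightarrow> bool" where
  "cops_win G k \<longleftrightarrow>
     (\<exists>c0 \<sigma>. cop_strategy G k c0 \<sigma> \<and> (\<forall>C R. play G c0 \<sigma> C R \<longrightarrow> captured C R))"

definition cop_number_inf :: "'a pair_pre_digraph \<Rightarrow> nat" ("c\<^sub>\<infinity>") where
  "c\<^sub>\<infinity> G = (LEAST k. cops_win G k)"

text \<open>The minimum is attained: one cop on every vertex wins at once.\<close>

lemma cops_win_card_verts:
  assumes "finite (pverts G)"
  shows "cops_win G (card (pverts G))"
proof -
  obtain c0 where c0: "set c0 = pverts G" "distinct c0"
    using finite_distinct_list[OF assms] by blast
  have "cop_strategy G (card (pverts G)) c0 (\<lambda>h. fst (last h))"
    using c0 by (auto simp: cop_strategy_def cop_positions_def cop_move_def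
        distinct_card[symmetric] list_all2_same)
  moreover have "captured C R" if "play G c0 (\<lambda>h. fst (last h)) C R" for C R
    using that c0 by (auto simp: play_def captured_def intro!: exI[of _ 0])
  ultimately show ?thesis unfolding cops_win_def by blast
qed

lemma cops_win_cop_number_inf:
  assumes "finite (pverts G)"
  shows "cops_win G (c\<^sub>\<infinity> G)"
  unfolding cop_number_inf_def using cops_win_card_verts[OF assms] by (rule LeastI)

end

theory Submission
  imports Defs
begin

text \<open>
  The number of cops needed on the \<open>n \<times> n\<close> grid lies between \<open>n - 1\<close> and \<open>n\<close>, because a line of
  \<open>n\<close> cops can march across the grid (\<open>cops_win_grid_sweep\<close>), while \<open>n - 2\<close> cops leave the robber a
  refuge at all times (\<open>not_cops_win_grid\<close>).

  For the lower bound, at most \<open>n - 2\<close> cops always leave rows and columns empty. These are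
  connected with each other, since every row meets every column. The robber tries to stay connected to
  them. He waits at a vertex \<open>(i, j)\<close> of an empty row and an empty column. If the next cop turn cuts him
  off, then his segment of row \<open>i\<close> lies over occupied columns only and ends at cops or at the
  border. The cops at its ends have just entered row \<open>i\<close> vertically, so they were in the same columns
  before. Hence an interval of columns around \<open>j\<close> has been occupied completely by cops from that
  same interval (\<open>walled_segment_covers\<close>), and likewise for the rows around \<open>i\<close>. This is a
  one-dimensional condition on each coordinate, and counting cops between empty lines shows that
  some line escapes it (\<open>safe_line_exists\<close>). The delicate case is a robber with cops on all four
  sides: his row then received two cops at once, and the safe row is chosen such that an interval
  around it cannot be covered with two cops in that row.

  For odd \<open>n\<close>, one cop is saved by starting with pairs on every second vertex of the main
  antidiagonal. The antidiagonals next to it have only \<open>n - 1\<close> vertices, and the pairs can occupy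
  either of them in one step, depending on the side that the robber has chosen
  (\<open>cops_win_odd_grid\<close>).

  For \<open>n \<le> 2\<close> the value \<open>n\<close> is seen directly: the robber survives without any cop, and on the
  four-cycle he survives one cop.
\<close>

section \<open>Playing the game\<close>

definition unguarded_arcs :: "'a pair_pre_digraph \<Rightarrow> 'a list \<Rightarrow> ('a \<times> 'a) set" where
  "unguarded_arcs G c = {(u, v) \<in> parcs G. u \<notin> set c \<and> v \<notin> set c}"

text \<open>
  How the cops confine the robber: he cannot leave a set of vertices whose exits are all guarded.
  If a cop stands on his own vertex, that vertex alone is such a set.
\<close>

lemma robber_move_stays_in_closed_set:
  assumes move: "robber_move G c r r'" and "r \<in> Q"
    and closed: "\<And>u v. (u, v) \<in> unguarded_arcs G c \<Longrightarrow> u \<in> Q \<Longrightarrow> v \<in> Q"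
  shows "r' \<in> Q"
proof (cases "r' = r")
  case False
  then obtain p where p: "vwalk p (with_proj G)" "hd p = r" "last p = r'" "set p \<inter> set c = {}"
    using move by (auto simp: robber_move_def vpath_def)
  have "p \<noteq> []" "set (vwalk_arcs p) \<subseteq> parcs G"
    using p(1) by (auto simp: vwalk_def)
  then have "last p \<in> Q" if "hd p \<in> Q"
    using that p(4)
  proof (induction p rule: vwalk_arcs.induct)
    case (3 x y xs)
    then have "y \<in> Q"
      using closed[of x y] by (auto simp: unguarded_arcs_def)
    with 3 show ?case by auto
  qed auto
  then show ?thesis using p \<open>r \<in> Q\<close> by simp
qed (use \<open>r \<in> Q\<close> in simp)

lemma robber_move_if_occupied:
  assumes "robber_move G c r r'" "r \<in> set c"
  shows "r' = r"
  using robber_move_stays_in_closed_set[OF assms(1), of "{r}"] assms(2)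
  by (auto simp: unguarded_arcs_def)

text \<open>
  How the robber gets away: reachability along unguarded arcs composes, whereas legal moves require
  paths without repeated vertices. Only the final walk has to be shortened to such a path.
\<close>

lemma robber_move_if_reachable:
  assumes "(r, r') \<in> (unguarded_arcs G c)\<^sup>*"
    and wf: "parcs G \<subseteq> pverts G \<times> pverts G"
  shows "robber_move G c r r'"
proof (cases "r' = r")
  case False
  with assms(1) have "(r, r') \<in> (unguarded_arcs G c)\<^sup>+"
    by (auto simp: rtrancl_eq_or_trancl)
  then have "\<exists>p. vwalk p (with_proj G) \<and> hd p = r \<and> last p = r' \<and> set p \<inter> set c = {}"
  proof (induction rule: converse_trancl_induct)
    case (base y)
    then show ?case using wf
      by (intro exI[of _ "[y, r']"]) (auto simp: unguarded_arcs_def vwalk_def)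
  next
    case (step y z)
    then obtain p where p: "vwalk p (with_proj G)" "hd p = z" "last p = r'" "set p \<inter> set c = {}"
      by blast
    then obtain q where q: "p = z # q" by (cases p) auto
    show ?case using p step(1) wf
      by (intro exI[of _ "y # p"]) (auto simp: q unguarded_arcs_def vwalk_def)
  qed
  then obtain p where p: "vwalk p (with_proj G)" "hd p = r" "last p = r'" "set p \<inter> set c = {}"
    by blast
  have "vpath (vwalk_to_vpath p) (with_proj G)" by (rule vwalk_to_vpath_vpath) fact
  moreover have "set (vwalk_to_vpath p) \<inter> set c = {}"
    using p(4) by (auto dest: vwalk_to_vpath_subset)
  ultimately show ?thesis
    unfolding robber_move_def using p by (metis vwalk_to_vpath_hd vwalk_to_vpath_last)
qed (simp add: robber_move_def)

lemma cop_move_positions: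
  assumes "cop_move G c c'" "c \<in> cop_positions G k" and wf: "parcs G \<subseteq> pverts G \<times> pverts G"
  shows "c' \<in> cop_positions G k"
proof -
  have "set c' \<subseteq> pverts G"
  proof
    fix v assume "v \<in> set c'"
    then obtain e where "e < length c'" "v = c' ! e" by (auto simp: in_set_conv_nth)
    then show "v \<in> pverts G"
      using assms nth_mem[of e c]
      by (fastforce simp: cop_move_def cop_positions_def list_all2_conv_all_nth)
  qed
  then show ?thesis
    using assms by (auto simp: cop_move_def cop_positions_def list_all2_lengthD)
qed

text \<open>
  With \<open>t\<close> full rounds left, the cops at \<open>c\<close> can force the robber at \<open>r\<close> onto one of their vertices
  by the end of the last round. Being caught in the middle of a round is included: a caught robber
  cannot move any more, so he is still caught at its end.
\<close>

primrec win_within :: "'a pair_pre_digraph \<Rightarrow> nat \<Rightarrow> 'a list \<Rightarrow> 'a \<Rightarrow> bool" where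
  "win_within G 0 c r \<longleftrightarrow> r \<in> set c"
| "win_within G (Suc t) c r \<longleftrightarrow>
     (\<exists>c'. cop_move G c c' \<and> (\<forall>r'. robber_move G c' r r' \<longrightarrow> win_within G t c' r'))"

lemma cop_move_refl: "cop_move G c c"
  by (simp add: cop_move_def list_all2_same)

lemma win_within_Suc:
  "win_within G t c r \<Longrightarrow> win_within G (Suc t) c r"
proof (induction t arbitrary: c r)
  case 0
  then have "\<forall>r'. robber_move G c r r' \<longrightarrow> r' \<in> set c"
    by (auto dest: robber_move_if_occupied)
  then show ?case by (auto intro: cop_move_refl)
next
  case (Suc t)
  from Suc.prems obtain c' where
    "cop_move G c c'" "\<And>r'. robber_move G c' r r' \<Longrightarrow> win_within G t c' r'"
    by auto
  with Suc.IH show ?case unfolding win_within.simps(2)[of G "Suc t"] by blast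
qed

lemma win_within_mono: "win_within G s c r \<Longrightarrow> s \<le> t \<Longrightarrow> win_within G t c r"
  by (induction t rule: nat_induct) (auto simp del: win_within.simps simp: le_Suc_eq intro: win_within_Suc)

lemma win_within_adjacent:
  assumes "u \<in> set c" "(u, r) \<in> parcs G"
  shows "win_within G 1 c r"
proof -
  define c' where "c' = map (\<lambda>x. if x = u then r else x) c"
  have "cop_move G c c'"
    using assms by (auto simp: cop_move_def c'_def list_all2_conv_all_nth)
  moreover have "r \<in> set c'" using assms by (auto simp: c'_def)
  ultimately show ?thesis by (auto dest: robber_move_if_occupied)
qed

text \<open>
  A strategy that looks only at the positions might repeat them forever. The length of the history
  is a clock: in each round the cops choose a move that is good for the number of rounds still left,
  so the horizon shrinks to \<open>0\<close> and the robber is caught by then.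
\<close>

lemma cops_win_if_win_within:
  assumes c0: "c0 \<in> cop_positions G k"
    and win: "\<And>r. r \<in> pverts G \<Longrightarrow> win_within G T c0 r"
  shows "cops_win G k"
proof -
  \<comment> \<open>\<open>good h c'\<close>: answering the history \<open>h\<close> with \<open>c'\<close> keeps the win within the horizon \<open>T\<close>.\<close>
  define good where "good = (\<lambda>h c'. cop_move G (fst (last h)) c' \<and>
    (\<forall>r'. robber_move G c' (snd (last h)) r' \<longrightarrow> win_within G (T - length h) c' r'))"
  define \<sigma> where "\<sigma> = (\<lambda>h. if \<exists>c'. good h c' then SOME c'. good h c' else fst (last h))"
  have good: "good h (\<sigma> h)" if "\<exists>c'. good h c'" for h
    using that by (auto simp: \<sigma>_def intro: someI_ex)
  have "cop_move G (fst (last h)) (\<sigma> h)" for h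
    using good[of h] by (cases "\<exists>c'. good h c'") (auto simp: \<sigma>_def good_def cop_move_refl)
  from this[of "_ @ [(_, _)]"] have strat: "cop_strategy G k c0 \<sigma>"
    using c0 by (auto simp: cop_strategy_def)
  have "captured C R" if play: "play G c0 \<sigma> C R" for C R
  proof -
    have "win_within G (T - t) (C t) (R t)" if "t \<le> T" for t
      using that
    proof (induction t)
      case 0
      then show ?case using play win by (auto simp: play_def)
    next
      case (Suc t)
      let ?h = "map (\<lambda>i. (C i, R i)) [0..<Suc t]"
      have last: "last ?h = (C t, R t)" "length ?h = Suc t" by auto
      have "T - t = Suc (T - Suc t)" using Suc.prems by simp
      with Suc have "win_within G (Suc (T - Suc t)) (C t) (R t)" by simp
      then have "\<exists>c'. good ?h c'" unfolding good_def last by simp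
      from good[OF this] have "good ?h (C (Suc t))"
        using play by (simp add: play_def del: upt_Suc)
      moreover have "robber_move G (C (Suc t)) (R t) (R (Suc t))" using play unfolding play_def by blast
      ultimately show ?case unfolding good_def last by simp
    qed
    from this[of T] show ?thesis by (auto simp: captured_def)
  qed
  with strat show ?thesis by (auto simp: cops_win_def)
qed

text \<open>
  The robber moves after the cops, so he may answer every cop position \<open>c\<close> with a vertex \<open>\<rho> c\<close>
  that depends on \<open>c\<close> alone. He survives if from \<open>\<rho> c\<close> he can still run to \<open>\<rho> c'\<close> whatever the next
  position \<open>c'\<close> of the cops is; the play that defeats a given strategy is then built by recursion.
\<close>

lemma not_cops_win_if_hideout:
  assumes wf: "parcs G \<subseteq> pverts G \<times> pverts G"
    and vert: "\<And>c. c \<in> cop_positions G k \<Longrightarrow> \<rho> c \<in> pverts G"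
    and safe: "\<And>c c'. c \<in> cop_positions G k \<Longrightarrow> c' \<in> cop_positions G k \<Longrightarrow>
      cop_move G c c' \<Longrightarrow> \<rho> c \<notin> set c' \<and> robber_move G c' (\<rho> c) (\<rho> c')"
  shows "\<not> cops_win G k"
proof
  assume "cops_win G k"
  then obtain c0 \<sigma> where strat: "cop_strategy G k c0 \<sigma>"
    and win: "\<And>C R. play G c0 \<sigma> C R \<Longrightarrow> captured C R"
    by (auto simp: cops_win_def)
  \<comment> \<open>\<open>H t\<close> is the history after \<open>t\<close> rounds.\<close>
  define H where "H = rec_nat [(c0, \<rho> c0)] (\<lambda>_ h. h @ [(\<sigma> h, \<rho> (\<sigma> h))])"
  have H0: "H 0 = [(c0, \<rho> c0)]" and HS: "H (Suc t) = H t @ [(\<sigma> (H t), \<rho> (\<sigma> (H t)))]" for t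
    by (auto simp: H_def)
  define C where "C = (\<lambda>t. fst (last (H t)))"
  have R: "snd (last (H t)) = \<rho> (C t)" for t
    by (cases t) (auto simp: H0 HS C_def)
  have C0: "C 0 = c0" and CS: "C (Suc t) = \<sigma> (H t)" for t by (auto simp: C_def H0 HS)
  have hist: "H t = map (\<lambda>i. (C i, \<rho> (C i))) [0..<Suc t]" for t
    by (induction t) (auto simp: H0 HS C0 CS)
  have move: "cop_move G (C t) (C (Suc t))" if "C t \<in> cop_positions G k" for t
  proof -
    have "H t = map (\<lambda>i. (C i, \<rho> (C i))) [0..<t] @ [(C t, \<rho> (C t))]"
      by (simp add: hist)
    then show ?thesis using strat that vert[OF that] by (auto simp: cop_strategy_def CS)
  qed
  have pos: "C t \<in> cop_positions G k" for t
  proof (induction t)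
    case 0
    then show ?case using strat by (simp add: cop_strategy_def C0)
  next
    case (Suc t)
    then show ?case using cop_move_positions[OF move] wf by blast
  qed
  note safe' = safe[OF pos pos move[OF pos]]
  have "play G c0 \<sigma> C (\<lambda>t. \<rho> (C t))"
    using safe' vert[OF pos] vert[OF pos[of 0]] by (auto simp: play_def C0 CS hist simp del: upt_Suc)
  from win[OF this] obtain t where "\<rho> (C t) \<in> set (C t) \<or> \<rho> (C t) \<in> set (C (Suc t))"
    by (auto simp: captured_def)
  then show False using safe' safe[OF pos pos cop_move_refl] by auto
qed

section \<open>Cops projected to a line\<close>

text \<open>
  In this part a family \<open>E\<close> of cops is seen through one coordinate, \<open>x e\<close> before and \<open>x' e\<close> after a
  cop turn; the lines \<open>0, 1, \<dots>\<close> stand for the columns of the grid, or for its rows. An interval of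
  lines that becomes occupied by means of its own cops is what the robber has to fear.
\<close>

definition covers :: "'e set \<Rightarrow> ('e \<Rightarrow> nat) \<Rightarrow> ('e \<Rightarrow> nat) \<Rightarrow> nat \<Rightarrow> nat \<Rightarrow> bool" where
  "covers E x x' L U \<longleftrightarrow> (\<forall>y\<in>{L..U}. \<exists>e\<in>E. x' e = y \<and> x e \<in> {L..U})"

definition short_move :: "nat \<Rightarrow> nat \<Rightarrow> bool" where
  "short_move p q \<longleftrightarrow> q \<le> Suc p \<and> p \<le> Suc q"

text \<open>
  Consider a block \<open>{A..<B}\<close> of lines with no cop just outside it before the turn. A cop
  travels at most one line, so every cop in the block after the turn was in the block before. If each
  line of the block either lies in the covered interval or was occupied anyway, distinct lines
  account for distinct cops of the block. Hence there are at least as many cops as lines, and one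
  more if some line is covered twice.
\<close>

lemma covered_block_count:
  assumes fin: "finite E" and steps: "\<forall>e\<in>E. short_move (x e) (x' e)"
    and cov: "covers E x x' L U"
    and left: "A = 0 \<or> (\<exists>f. A = Suc f \<and> (\<forall>e\<in>E. x e \<noteq> f))"
    and right: "\<forall>e\<in>E. x e \<noteq> B"
    and rest: "\<And>y. y \<in> {A..<B} \<Longrightarrow> y \<notin> {L..U} \<Longrightarrow> \<exists>e\<in>E. x e = y"
  shows "B - A \<le> card {e \<in> E. A \<le> x e \<and> x e < B}"
    and "\<lbrakk>j \<in> {A..<B}; L < j; j < U; e1 \<in> E; e2 \<in> E; e1 \<noteq> e2; x' e1 = j; x' e2 = j\<rbrakk>
      \<Longrightarrow> Suc (B - A) \<le> card {e \<in> E. A \<le> x e \<and> x e < B}"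
proof -
  let ?D = "{e \<in> E. A \<le> x e \<and> x e < B}"
  \<comment> \<open>\<open>v e\<close> is the line for which the cop \<open>e\<close> accounts: her new line if she starts in the covered
    interval, and her old line otherwise.\<close>
  define v where "v = (\<lambda>e. if x e \<in> {L..U} then x' e else x e)"
  have inD: "e \<in> ?D" if e: "e \<in> E" "x' e \<in> {A..<B}" for e
  proof -
    have "x e \<noteq> B" "A = 0 \<or> Suc (x e) \<noteq> A" "short_move (x e) (x' e)"
      using e left right steps by auto
    then show ?thesis using e by (auto simp: short_move_def)
  qed
  have surj: "{A..<B} \<subseteq> v ` ?D"
  proof
    fix y assume y: "y \<in> {A..<B}"
    show "y \<in> v ` ?D"
    proof (cases "y \<in> {L..U}")
      case True
      then obtain e where "e \<in> E" "x' e = y" "x e \<in> {L..U}" using cov unfolding covers_def by blast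
      then show ?thesis using inD[of e] y by (intro image_eqI[of _ _ e]) (auto simp: v_def)
    next
      case False
      then obtain e where "e \<in> E" "x e = y" using rest[OF y] by blast
      then show ?thesis using y False by (intro image_eqI[of _ _ e]) (auto simp: v_def)
    qed
  qed
  have finD: "finite ?D" using fin by simp
  show "B - A \<le> card ?D" using surj_card_le[OF finD surj] by simp
  show "Suc (B - A) \<le> card ?D"
    if j: "j \<in> {A..<B}" "L < j" "j < U" and e: "e1 \<in> E" "e2 \<in> E" "e1 \<noteq> e2" "x' e1 = j" "x' e2 = j"
  proof -
    have D: "e1 \<in> ?D" "e2 \<in> ?D" using inD j e by auto
    have "short_move (x e1) j" "short_move (x e2) j" using steps e by auto
    then have "v e1 = v e2" using j e by (auto simp: v_def short_move_def)
    then have "v e2 \<in> v ` (?D - {e2})" using D e(3) by (intro image_eqI[of _ _ e1]) auto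
    then have "v ` ?D \<subseteq> v ` (?D - {e2})" by auto
    with surj have "{A..<B} \<subseteq> v ` (?D - {e2})" by blast
    then have "B - A \<le> card (?D - {e2})" using surj_card_le[of "?D - {e2}"] finD by fastforce
    moreover have "card ?D = Suc (card (?D - {e2}))" using finD D(2) by (rule card.remove)
    ultimately show ?thesis by simp
  qed
qed

text \<open>
  A safe line is empty, and after any cop turn it is not caught in an interval that the cops
  starting in that interval cover completely, when the interval reaches the border or when two cops
  end on the line. For the robber standing on the line, the two cases correspond to being walled in
  against the border and being walled in by a cop on either side.
\<close>

definition safe_line :: "nat \<Rightarrow> 'e set \<Rightarrow> ('e \<Rightarrow> nat) \<Rightarrow> nat \<Rightarrow> bool" where
  "safe_line n E x j \<longleftrightarrow> j < n \<and> (\<forall>e\<in>E. x e \<noteq> j) \<and>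
     (\<forall>x' L U. (\<forall>e\<in>E. short_move (x e) (x' e)) \<longrightarrow> covers E x x' L U \<longrightarrow> L \<le> j \<longrightarrow> j \<le> U \<longrightarrow> U < n \<longrightarrow>
        L \<noteq> 0 \<and> U \<noteq> n - 1 \<and>
        (L < j \<and> j < U \<longrightarrow> (\<forall>e1\<in>E. \<forall>e2\<in>E. x' e1 = j \<and> x' e2 = j \<longrightarrow> e1 = e2)))"

lemma safe_lineD:
  assumes "safe_line n E x j" "\<forall>e\<in>E. short_move (x e) (x' e)" "covers E x x' L U"
    "L \<le> j" "j \<le> U" "U < n"
  shows "L \<noteq> 0" "U \<noteq> n - 1"
    "\<lbrakk>L < j; j < U; e1 \<in> E; e2 \<in> E; x' e1 = j; x' e2 = j\<rbrakk> \<Longrightarrow> e1 = e2"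
  using assms unfolding safe_line_def by blast+

text \<open>
  Compare the number \<open>N y\<close> of cops before line \<open>y\<close> with \<open>y\<close>. Seen from the far border \<open>n\<close>, there are
  too few cops. Let \<open>z\<close> be the first empty line (or \<open>n\<close>) with \<open>N z < z\<close>, and \<open>j\<close> the last empty line
  before \<open>z\<close>. Up to \<open>z\<close> the cops are one too few to cover everything. Up to any empty line
  \<open>f \<le> j\<close> there are at least \<open>f\<close> of them, which leaves too few cops beyond \<open>f\<close> to cover the rest,
  and no spare cop between \<open>f\<close> and \<open>z\<close> to cover \<open>j\<close> twice. The blocks of lines that start and end
  next to an empty line make these counts precise.
\<close>

lemma safe_line_exists:
  assumes fin: "finite E" and few: "card E + 2 \<le> n" and range: "\<forall>e\<in>E. x e < n"
  shows "\<exists>j. safe_line n E x j"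
proof -
  define free where "free y \<longleftrightarrow> (\<forall>e\<in>E. x e \<noteq> y)" for y
  define N where "N y = card {e \<in> E. x e < y}" for y
  define deficient where "deficient z \<longleftrightarrow> free z \<and> N z < z" for z
  have "N n \<le> card E" unfolding N_def using fin by (intro card_mono) auto
  then have n: "deficient n" using range few by (auto simp: deficient_def free_def)
  define z where "z = (LEAST z. deficient z)"
  have z: "free z" "N z < z" and "z \<le> n"
    using LeastI[of deficient, OF n] Least_le[of deficient, OF n]
    by (auto simp: z_def deficient_def)
  have before: "f \<le> N f" if "f < z" "free f" for f
    using not_less_Least[of f deficient] that by (auto simp: z_def deficient_def)
  \<comment> \<open>The block that ends at \<open>b\<close> is prolonged downwards until it meets an empty line or the border.\<close>
  have last_free: "\<exists>A\<le>b. (A = 0 \<or> (\<exists>f. A = Suc f \<and> free f)) \<and> (\<forall>y\<in>{A..<b}. \<not> free y)" for b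
  proof (induction b)
    case (Suc b)
    show ?case
    proof (cases "free b")
      case True
      then show ?thesis by (intro exI[of _ "Suc b"]) auto
    next
      case False
      from Suc obtain A where "A \<le> b" "A = 0 \<or> (\<exists>f. A = Suc f \<and> free f)" "\<forall>y\<in>{A..<b}. \<not> free y"
        by blast
      with False show ?thesis by (intro exI[of _ A]) (auto simp: less_Suc_eq)
    qed
  qed auto
  \<comment> \<open>As line \<open>f\<close> is empty, the cops before \<open>B\<close> are those before \<open>f\<close> and those of the block after \<open>f\<close>.\<close>
  have count: "card {e \<in> E. A \<le> x e \<and> x e < B} + N f = N B"
    if "A = Suc f" "free f" "A \<le> B" for A B f
  proof -
    have "{e \<in> E. x e < B} = {e \<in> E. A \<le> x e \<and> x e < B} \<union> {e \<in> E. x e < f}"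
      using that by (auto simp: free_def Suc_le_eq nat_neq_iff)
    moreover have "{e \<in> E. A \<le> x e \<and> x e < B} \<inter> {e \<in> E. x e < f} = {}" using that by auto
    ultimately show ?thesis unfolding N_def using fin by (simp add: card_Un_disjoint)
  qed
  have count0: "card {e \<in> E. 0 \<le> x e \<and> x e < B} = N B" for B by (simp add: N_def)
  obtain A where A: "A \<le> z" "A = 0 \<or> (\<exists>f. A = Suc f \<and> free f)" "\<forall>y\<in>{A..<z}. \<not> free y"
    using last_free by blast
  have "A \<noteq> 0"
  proof
    assume "A = 0"
    then have "{..<z} \<subseteq> x ` {e \<in> E. x e < z}" using A(3) by (force simp: free_def)
    then have "z \<le> N z" unfolding N_def using surj_card_le[of "{e \<in> E. x e < z}"] fin by fastforce
    then show False using z by simp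
  qed
  with A obtain j where j: "free j" "j < z" "\<And>y. j < y \<Longrightarrow> y < z \<Longrightarrow> \<not> free y" by force
  have occ: "\<not> free y \<Longrightarrow> \<exists>e\<in>E. x e = y" for y by (auto simp: free_def)
  have "L \<noteq> 0 \<and> U \<noteq> n - 1 \<and>
        (L < j \<and> j < U \<longrightarrow> (\<forall>e1\<in>E. \<forall>e2\<in>E. x' e1 = j \<and> x' e2 = j \<longrightarrow> e1 = e2))"
    if st: "\<forall>e\<in>E. short_move (x e) (x' e)" and cov: "covers E x x' L U"
      and LU: "L \<le> j" "j \<le> U" "U < n" for x' L U
  proof (intro conjI impI ballI notI)
    \<comment> \<open>The block \<open>{0..<z}\<close> has \<open>N z < z\<close> cops.\<close>
    assume "L = 0"
    have "z - 0 \<le> card {e \<in> E. 0 \<le> x e \<and> x e < z}"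
      by (rule covered_block_count(1)[OF fin st cov])
        (use z LU j(3) \<open>L = 0\<close> occ in \<open>auto simp: free_def\<close>)
    then show False using z by (simp add: N_def)
  next
    \<comment> \<open>The block runs from the last empty line \<open>f\<close> before \<open>L\<close> to the border; \<open>f \<le> N f\<close> cops are outside.\<close>
    assume "U = n - 1"
    obtain A where A: "A \<le> L" "A = 0 \<or> (\<exists>f. A = Suc f \<and> free f)" "\<forall>y\<in>{A..<L}. \<not> free y"
      using last_free by blast
    have "n - A \<le> card {e \<in> E. A \<le> x e \<and> x e < n}"
      by (rule covered_block_count(1)[OF fin st cov])
        (use range A LU \<open>U = n - 1\<close> in \<open>auto simp: free_def\<close>)
    moreover have "A = 0 \<Longrightarrow> N n < n" using n by (simp add: deficient_def)
    moreover have "N n + 2 \<le> n" using \<open>N n \<le> card E\<close> few by simp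
    moreover have "f \<le> N f" if "A = Suc f" "free f" for f
      using before[of f] that A(1) LU(1) j(2) by simp
    ultimately show False using A(1,2) LU j(2) \<open>z \<le> n\<close> count[of A _ n] count0[of n]
      by fastforce
  next
    fix e1 e2 assume e: "e1 \<in> E" "e2 \<in> E" "x' e1 = j \<and> x' e2 = j" and inner: "L < j \<and> j < U"
    show "e1 = e2"
    proof (rule ccontr)
      \<comment> \<open>The block runs from the last empty line \<open>f\<close> before \<open>j\<close> to \<open>z\<close>, with at most \<open>z - 1 - f\<close> cops.\<close>
      assume "e1 \<noteq> e2"
      obtain A where A: "A \<le> j" "A = 0 \<or> (\<exists>f. A = Suc f \<and> free f)" "\<forall>y\<in>{A..<j}. \<not> free y"
        using last_free by blast
      have rest: "\<exists>e\<in>E. x e = y" if "y \<in> {A..<z}" "y \<notin> {L..U}" for y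
        using that inner j(3)[of y] A(3) occ[of y] by (cases "y < j") auto
      have "Suc (z - A) \<le> card {e \<in> E. A \<le> x e \<and> x e < z}"
        by (rule covered_block_count(2)[OF fin st cov _ _ _, where j = j and ?e1.0 = e1 and ?e2.0 = e2])
          (use z A(1,2) j(2) rest e inner \<open>e1 \<noteq> e2\<close> in \<open>auto simp: free_def\<close>)
      moreover have "f \<le> N f" if "A = Suc f" "free f" for f
        using before[of f] that A(1) j(2) by simp
      ultimately show False using A(1,2) j(2) z(2) count[of A _ z] count0[of z] by fastforce
    qed
  qed
  then have "safe_line n E x j"
    using j \<open>z \<le> n\<close> unfolding safe_line_def free_def by (intro conjI allI impI) auto
  then show ?thesis ..
qed

section \<open>The robber in the grid\<close>

abbreviation grid :: "nat \<Rightarrow> (nat \<times> nat) pair_pre_digraph" where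
  "grid n \<equiv> path_graph n \<box> path_graph n"

lemma verts_grid: "pverts (grid n) = {..<n} \<times> {..<n}"
  by (simp add: cartesian_prod_def path_graph_def)

lemma arcs_grid_iff:
  "((a, b), (a', b')) \<in> parcs (grid n) \<longleftrightarrow> a < n \<and> b < n \<and> a' < n \<and> b' < n \<and>
     (a' = a \<and> (b' = Suc b \<or> b = Suc b') \<or> b' = b \<and> (a' = Suc a \<or> a = Suc a'))"
  by (auto simp: cartesian_prod_def path_graph_def)

lemma wf_grid: "parcs (grid n) \<subseteq> pverts (grid n) \<times> pverts (grid n)"
  by (auto simp: arcs_grid_iff verts_grid)

definition axis_move :: "nat \<Rightarrow> nat \<Rightarrow> nat \<Rightarrow> nat \<Rightarrow> bool" where
  "axis_move a b a' b' \<longleftrightarrow> a' = a \<and> short_move b b' \<or> b' = b \<and> short_move a a'"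

text \<open>
  The cops are at \<open>(a e, b e)\<close> before and at \<open>(a' e, b' e)\<close> after their turn, and the robber is at
  \<open>(i, j)\<close> in a line \<open>a = i\<close> that was empty. Walk from \<open>j\<close> in both directions along this line until
  the first cop or the border, to \<open>L\<close> and to \<open>U\<close>. A cop met there has just entered the line, so
  she moved across it and her second coordinate was \<open>L\<close> or \<open>U\<close> before as well. The other
  coordinates of the segment are occupied by assumption, by cops that came from distance at most one.
  So the whole of \<open>{L..U}\<close> is covered from within. If the walk meets a cop on both sides, two cops
  have entered the line.

  The statement treats the two coordinates as abstract functions, so that it applies to rows and to
  columns alike.
\<close>

lemma walled_segment_covers:
  fixes a b a' b' :: "'e \<Rightarrow> nat"
  assumes moves: "\<forall>e\<in>E. axis_move (a e) (b e) (a' e) (b' e)"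
    and empty: "\<forall>e\<in>E. a e \<noteq> i" and range: "\<forall>e\<in>E. b e < n" and "j < n"
    and uncaught: "\<not> (\<exists>e\<in>E. a' e = i \<and> b' e = j)"
    and walled: "\<And>y. y < n \<Longrightarrow> (\<forall>w\<in>{min j y..max j y}. \<not> (\<exists>e\<in>E. a' e = i \<and> b' e = w))
      \<Longrightarrow> \<exists>e\<in>E. b' e = y"
  shows "\<exists>L U. L \<le> j \<and> j \<le> U \<and> U < n \<and> covers E b b' L U \<and>
    (L = 0 \<or> U = n - 1 \<or> L < j \<and> j < U \<and>
      (\<exists>e1\<in>E. \<exists>e2\<in>E. e1 \<noteq> e2 \<and> a' e1 = i \<and> a' e2 = i))"
proof -
  define occ where "occ w \<longleftrightarrow> (\<exists>e\<in>E. a' e = i \<and> b' e = w)" for w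
  have nocc: "\<not> occ j" using uncaught by (simp add: occ_def)
  have "\<exists>L\<le>j. (\<forall>w. L < w \<and> w \<le> j \<longrightarrow> \<not> occ w) \<and> (L = 0 \<or> occ L)"
  proof (cases "\<exists>w<j. occ w")
    case True
    then have S: "finite {w. w < j \<and> occ w}" "{w. w < j \<and> occ w} \<noteq> {}" by auto
    obtain L where "L < j \<and> occ L" "\<And>w. w < j \<and> occ w \<Longrightarrow> w \<le> L"
      using Max_in[OF S] Max_ge[OF S(1)] by blast
    then show ?thesis using nocc by (metis le_neq_implies_less less_imp_le not_le)
  next
    case False
    then show ?thesis using nocc by (intro exI[of _ 0]) (auto simp: le_less)
  qed
  then obtain L where
    L: "L \<le> j" "\<And>w. L < w \<Longrightarrow> w \<le> j \<Longrightarrow> \<not> occ w" "L = 0 \<or> occ L" by blast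
  have "\<exists>U\<ge>j. U < n \<and> (\<forall>w. j \<le> w \<and> w < U \<longrightarrow> \<not> occ w) \<and> (U = n - 1 \<or> occ U)"
  proof (cases "\<exists>w>j. w < n \<and> occ w")
    case True
    then have S: "finite {w. j < w \<and> w < n \<and> occ w}" "{w. j < w \<and> w < n \<and> occ w} \<noteq> {}" by auto
    obtain U where "j < U \<and> U < n \<and> occ U" "\<And>w. j < w \<and> w < n \<and> occ w \<Longrightarrow> U \<le> w"
      using Min_in[OF S] Min_le[OF S(1)] by blast
    then show ?thesis using nocc by (metis le_neq_implies_less less_imp_le less_trans not_le)
  next
    case False
    then have "\<not> occ w" if "j \<le> w" "w < n" for w using that nocc by (cases "w = j") auto
    then show ?thesis using \<open>j < n\<close> by (intro exI[of _ "n - 1"]) auto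
  qed
  then obtain U where
    U: "j \<le> U" "U < n" "\<And>w. j \<le> w \<Longrightarrow> w < U \<Longrightarrow> \<not> occ w" "U = n - 1 \<or> occ U" by blast
  have "\<exists>e\<in>E. b' e = y \<and> b e \<in> {L..U}" if y: "y \<in> {L..U}" for y
  proof (cases "occ y")
    case True
    then obtain e where "e \<in> E" "a' e = i" "b' e = y" by (auto simp: occ_def)
    moreover then have "b e = y" using moves empty unfolding axis_move_def by metis
    ultimately show ?thesis using y by auto
  next
    case False
    have "\<not> occ w" if "w \<in> {min j y..max j y}" for w
      using that y False L(1,2) U(1,3) nocc
      by (cases "w = y"; cases "w = j"; cases "w < j") (auto simp: min_def max_def split: if_splits)
    then obtain e where e: "e \<in> E" "b' e = y"
      using walled[of y] y U(2) unfolding occ_def by auto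
    then have "short_move (b e) y" "b e < n"
      using moves range by (auto simp: axis_move_def short_move_def)
    moreover have "L = 0 \<or> L < y" "U = n - 1 \<or> y < U"
      using y False L(3) U(4) by (cases "y = L"; cases "y = U"; simp)+
    ultimately have "b e \<in> {L..U}" unfolding short_move_def by auto
    with e show ?thesis by blast
  qed
  then have "covers E b b' L U" by (auto simp: covers_def)
  moreover have "L < j \<and> j < U \<and> (\<exists>e1\<in>E. \<exists>e2\<in>E. e1 \<noteq> e2 \<and> a' e1 = i \<and> a' e2 = i)"
    if "L \<noteq> 0" "U \<noteq> n - 1"
  proof -
    have "occ L" "occ U" using that L U by auto
    then obtain e1 e2 where e: "e1 \<in> E" "a' e1 = i" "b' e1 = L" "e2 \<in> E" "a' e2 = i" "b' e2 = U"
      unfolding occ_def by blast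
    have LU: "L < j" "j < U" using \<open>occ L\<close> \<open>occ U\<close> nocc L(1) U(1)
      by (cases "L = j"; cases "U = j"; simp)+
    then have "e1 \<noteq> e2" using e by auto
    with e LU show ?thesis by blast
  qed
  ultimately show ?thesis
    by (intro exI[of _ L] exI[of _ U] conjI) (use L(1) U(1,2) in argo)+
qed

lemma line_reachable:
  assumes "sym A" and step: "\<And>w. min p q \<le> w \<Longrightarrow> w < max p q \<Longrightarrow> (f w, f (Suc w)) \<in> A"
  shows "(f p, f (q::nat)) \<in> A\<^sup>*"
proof -
  have up: "(f p, f q) \<in> A\<^sup>*" if "p \<le> q" "\<And>w. p \<le> w \<Longrightarrow> w < q \<Longrightarrow> (f w, f (Suc w)) \<in> A" for p q
    using that by (induction q rule: nat_induct) (auto simp: le_Suc_eq intro: rtrancl_into_rtrancl)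
  show ?thesis
  proof (cases "p \<le> q")
    case False
    then have "(f q, f p) \<in> A\<^sup>*" using up[of q p] step by (auto simp: min_def max_def)
    then show ?thesis using sym_rtrancl[OF assms(1)] by (auto dest: symD)
  qed (use up[of p q] step in \<open>auto simp: min_def max_def\<close>)
qed

lemma sym_unguarded_arcs_grid: "sym (unguarded_arcs (grid n) c)"
  by (rule symI) (auto simp: unguarded_arcs_def arcs_grid_iff)

lemma row_reachable:
  assumes "x < n" "y < n" "y' < n" "\<And>w. w \<in> {min y y'..max y y'} \<Longrightarrow> (x, w) \<notin> set c"
  shows "((x, y), (x, y')) \<in> (unguarded_arcs (grid n) c)\<^sup>*"
proof (rule line_reachable[OF sym_unguarded_arcs_grid])
  fix w assume "min y y' \<le> w" "w < max y y'"
  then show "((x, w), (x, Suc w)) \<in> unguarded_arcs (grid n) c"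
    using assms by (auto simp: unguarded_arcs_def arcs_grid_iff)
qed

lemma column_reachable:
  assumes "y < n" "x < n" "x' < n" "\<And>w. w \<in> {min x x'..max x x'} \<Longrightarrow> (w, y) \<notin> set c"
  shows "((x, y), (x', y)) \<in> (unguarded_arcs (grid n) c)\<^sup>*"
proof (rule line_reachable[OF sym_unguarded_arcs_grid, where f = "\<lambda>w. (w, y)"])
  fix w assume "min x x' \<le> w" "w < max x x'"
  then show "((w, y), (Suc w, y)) \<in> unguarded_arcs (grid n) c"
    using assms by (auto simp: unguarded_arcs_def arcs_grid_iff)
qed

definition safe_vertex :: "nat \<Rightarrow> nat \<Rightarrow> (nat \<times> nat) list \<Rightarrow> nat \<times> nat \<Rightarrow> bool" where
  "safe_vertex n k c v \<longleftrightarrow> safe_line n {..<k} (\<lambda>e. fst (c ! e)) (fst v) \<and>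
     safe_line n {..<k} (\<lambda>e. snd (c ! e)) (snd v)"

text \<open>
  An empty row meets every empty column, so the robber can run from \<open>(i, j)\<close> to \<open>(i', j')\<close> as soon as
  he reaches some column that is empty at \<open>c'\<close> by moving along row \<open>i\<close>, or some such row along
  column \<open>j\<close>. If he can do neither, the cops cover an interval of columns around \<open>j\<close> and an interval
  of rows around \<open>i\<close> from within. Neither interval reaches the border, because \<open>j\<close> and \<open>i\<close> are
  safe. So the segment in row \<open>i\<close> ends at two cops; they put two cops into row \<open>i\<close>, which lies in
  the interior of its interval, against the safety of \<open>i\<close>.
\<close>

lemma robber_escapes_from_safe_vertex:
  assumes c: "c \<in> cop_positions (grid n) k" and c': "c' \<in> cop_positions (grid n) k"
    and move: "cop_move (grid n) c c'"
    and safe: "safe_vertex n k c (i, j)" and safe': "safe_vertex n k c' (i', j')"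
  shows "(i, j) \<notin> set c' \<and> robber_move (grid n) c' (i, j) (i', j')"
proof -
  let ?E = "{..<k}"
  let ?R = "(unguarded_arcs (grid n) c')\<^sup>*"
  let ?a = "\<lambda>e. fst (c ! e)" and ?b = "\<lambda>e. snd (c ! e)"
  let ?a' = "\<lambda>e. fst (c' ! e)" and ?b' = "\<lambda>e. snd (c' ! e)"
  note row = safe[unfolded safe_vertex_def fst_conv snd_conv, THEN conjunct1]
  note col = safe[unfolded safe_vertex_def fst_conv snd_conv, THEN conjunct2]
  have len: "length c = k" "length c' = k" using c c' by (auto simp: cop_positions_def)
  have range: "?a e < n" "?b e < n" if "e < k" for e
  proof -
    have "c ! e \<in> set c" using that len by simp
    then have "c ! e \<in> pverts (grid n)" using c by (auto simp: cop_positions_def)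
    then show "?a e < n" "?b e < n" by (cases "c ! e"; simp add: verts_grid)+
  qed
  have axis: "axis_move (?a e) (?b e) (?a' e) (?b' e)" if "e < k" for e
  proof -
    have "c' ! e = c ! e \<or> (c ! e, c' ! e) \<in> parcs (grid n)"
      using move that len by (auto simp: cop_move_def list_all2_conv_all_nth)
    then show ?thesis
      by (cases "c ! e"; cases "c' ! e")
        (auto simp: axis_move_def short_move_def arcs_grid_iff)
  qed
  have empty: "?a e \<noteq> i" "?b e \<noteq> j" if "e < k" for e
    using row col that by (auto simp: safe_line_def)
  have ij: "i < n" "j < n" using row col by (auto simp: safe_line_def)
  have ij': "i' < n" "j' < n" using safe' by (auto simp: safe_vertex_def safe_line_def)
  have occ: "(x, y) \<in> set c' \<longleftrightarrow> (\<exists>e\<in>?E. ?a' e = x \<and> ?b' e = y)" for x y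
    using len by (auto simp: in_set_conv_nth Bex_def prod_eq_iff)
  have empty': "(i', y) \<notin> set c'" "(x, j') \<notin> set c'" for x y
    using safe' by (auto simp: occ safe_vertex_def safe_line_def)
  have uncaught: "(i, j) \<notin> set c'"
    unfolding occ using axis empty by (fastforce simp: axis_move_def)
  have "((i, j), (i', j')) \<in> ?R"
  proof (rule ccontr)
    assume cut: "((i, j), (i', j')) \<notin> ?R"
    have walled_row: "\<exists>e\<in>?E. ?b' e = y"
      if y: "y < n" and seg: "\<forall>w\<in>{min j y..max j y}. \<not> (\<exists>e\<in>?E. ?a' e = i \<and> ?b' e = w)" for y
    proof (rule ccontr)
      assume no: "\<not> (\<exists>e\<in>?E. ?b' e = y)"
      have "((i, j), (i, y)) \<in> ?R" by (rule row_reachable) (use ij y seg occ in auto)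
      also have "((i, y), (i', y)) \<in> ?R" by (rule column_reachable) (use ij ij' y no occ in auto)
      also have "((i', y), (i', j')) \<in> ?R" by (rule row_reachable) (use ij' y empty' in auto)
      finally show False using cut by simp
    qed
    have walled_col: "\<exists>e\<in>?E. ?a' e = x"
      if x: "x < n" and seg: "\<forall>w\<in>{min i x..max i x}. \<not> (\<exists>e\<in>?E. ?b' e = j \<and> ?a' e = w)" for x
    proof (rule ccontr)
      assume no: "\<not> (\<exists>e\<in>?E. ?a' e = x)"
      have "((i, j), (x, j)) \<in> ?R" by (rule column_reachable) (use ij x seg occ in auto)
      also have "((x, j), (x, j')) \<in> ?R" by (rule row_reachable) (use ij ij' x no occ in auto)
      also have "((x, j'), (i', j')) \<in> ?R" by (rule column_reachable) (use ij' x empty' in auto)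
      finally show False using cut by simp
    qed
    have short: "short_move (?a e) (?a' e)" "short_move (?b e) (?b' e)" if "e < k" for e
      using axis[OF that] by (auto simp: axis_move_def short_move_def)
    obtain L U where LU: "L \<le> j" "j \<le> U" "U < n" "covers ?E ?b ?b' L U"
      and LU': "L = 0 \<or> U = n - 1 \<or> (\<exists>e1\<in>?E. \<exists>e2\<in>?E. e1 \<noteq> e2 \<and> ?a' e1 = i \<and> ?a' e2 = i)"
      using walled_segment_covers[of ?E ?a ?b ?a' ?b' i n j] axis empty range ij uncaught walled_row
      unfolding occ by blast
    have "axis_move (?b e) (?a e) (?b' e) (?a' e)" if "e < k" for e
      using axis[OF that] by (auto simp: axis_move_def)
    then obtain L' U' where LUv: "L' \<le> i" "i \<le> U'" "U' < n" "covers ?E ?a ?a' L' U'"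
      and LUv': "L' = 0 \<or> U' = n - 1 \<or> L' < i \<and> i < U'"
      using walled_segment_covers[of ?E ?b ?a ?b' ?a' j n i] empty range ij uncaught walled_col
      unfolding occ by blast
    have "L \<noteq> 0" "U \<noteq> n - 1"
      using safe_lineD(1,2)[OF col _ LU(4,1,2,3)] short(2) by auto
    then obtain e1 e2 where e: "e1 \<in> ?E" "e2 \<in> ?E" "e1 \<noteq> e2" "?a' e1 = i" "?a' e2 = i"
      using LU' by blast
    have short': "\<forall>e\<in>?E. short_move (?a e) (?a' e)" using short(1) by simp
    note vertical = safe_lineD[OF row short' LUv(4,1,2,3)]
    have "L' < i" "i < U'" using LUv' vertical(1,2) by auto
    from vertical(3)[OF this e(1,2,4,5)] show False using e(3) by simp
  qed
  then show ?thesis using uncaught wf_grid by (auto intro: robber_move_if_reachable)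
qed

lemma not_cops_win_grid:
  assumes "k + 2 \<le> n"
  shows "\<not> cops_win (grid n) k"
proof -
  define \<rho> where "\<rho> c = (SOME v. safe_vertex n k c v)" for c
  have safe: "safe_vertex n k c (\<rho> c)" if c: "c \<in> cop_positions (grid n) k" for c
  proof -
    have "c ! e \<in> {..<n} \<times> {..<n}" if "e < k" for e
      using c nth_mem[of e c] that by (auto simp: cop_positions_def verts_grid)
    then have "\<forall>e\<in>{..<k}. fst (c ! e) < n" "\<forall>e\<in>{..<k}. snd (c ! e) < n"
      by (auto simp: mem_Times_iff)
    then obtain i j where "safe_line n {..<k} (\<lambda>e. fst (c ! e)) i"
      "safe_line n {..<k} (\<lambda>e. snd (c ! e)) j"
      using safe_line_exists[of "{..<k}" n] assms by (metis card_lessThan finite_lessThan)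
    then have "safe_vertex n k c (i, j)" by (simp add: safe_vertex_def)
    then show ?thesis unfolding \<rho>_def by (rule someI)
  qed
  show ?thesis
  proof (rule not_cops_win_if_hideout[OF wf_grid, where \<rho> = \<rho>])
    show "\<rho> c \<in> pverts (grid n)" if "c \<in> cop_positions (grid n) k" for c
      using safe[OF that] by (auto simp: safe_vertex_def safe_line_def verts_grid mem_Times_iff)
  next
    fix c c' assume c: "c \<in> cop_positions (grid n) k" "c' \<in> cop_positions (grid n) k"
      and "cop_move (grid n) c c'"
    then show "\<rho> c \<notin> set c' \<and> robber_move (grid n) c' (\<rho> c) (\<rho> c')"
      using robber_escapes_from_safe_vertex[of c n k c' "fst (\<rho> c)" "snd (\<rho> c)"
          "fst (\<rho> c')" "snd (\<rho> c')"] safe[OF c(1)] safe[OF c(2)]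
      by simp
  qed
qed

lemma not_cops_win_without_cops:
  assumes "n \<ge> 1"
  shows "\<not> cops_win (grid n) 0"
  by (rule not_cops_win_if_hideout[OF wf_grid, where \<rho> = "\<lambda>_. (0, 0)"])
    (use assms in \<open>auto simp: verts_grid cop_positions_def robber_move_def\<close>)

text \<open>
  On the four-cycle the robber always stands opposite to the single cop.
\<close>

lemma not_cops_win_four_cycle: "\<not> cops_win (grid 2) 1"
proof (rule not_cops_win_if_hideout[OF wf_grid, where \<rho> = "\<lambda>c. (1 - fst (hd c), 1 - snd (hd c))"])
  fix c c' assume "c \<in> cop_positions (grid 2) 1" "c' \<in> cop_positions (grid 2) 1"
    and move: "cop_move (grid 2) c c'"
  then obtain a b p q where c: "c = [(a, b)]" "c' = [(p, q)]" "a < 2" "b < 2" "p < 2" "q < 2"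
    by (auto simp: cop_positions_def length_Suc_conv verts_grid)
  have adj: "(p, q) = (a, b) \<or> ((a, b), (p, q)) \<in> parcs (grid 2)"
    using move c by (auto simp: cop_move_def)
  have "((1 - a, 1 - b), (1 - p, 1 - q)) \<in> (unguarded_arcs (grid 2) c')\<^sup>*"
    using adj c by (auto simp: arcs_grid_iff unguarded_arcs_def less_2_cases_iff intro: r_into_rtrancl)
  moreover have "(1 - a, 1 - b) \<noteq> (p, q)"
    using adj c by (auto simp: arcs_grid_iff less_2_cases_iff)
  ultimately show "(1 - fst (hd c), 1 - snd (hd c)) \<notin> set c' \<and>
      robber_move (grid 2) c' (1 - fst (hd c), 1 - snd (hd c)) (1 - fst (hd c'), 1 - snd (hd c'))"
    using robber_move_if_reachable[OF _ wf_grid] c by simp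
qed (auto simp: verts_grid)

section \<open>The cops in the grid\<close>

text \<open>
  Levels change by at most one along an arc, so a robber at level at most \<open>s\<close> cannot pass a
  completely guarded level \<open>s\<close>.
\<close>

lemma win_within_behind_barrier:
  fixes h :: "'a \<Rightarrow> nat"
  assumes wf: "parcs G \<subseteq> pverts G \<times> pverts G"
    and lip: "\<And>u v. (u, v) \<in> parcs G \<Longrightarrow> h v \<le> Suc (h u)"
    and move: "cop_move G c c'" and cov: "{v \<in> pverts G. h v = s} \<subseteq> set c'"
    and r: "r \<in> pverts G" "h r \<le> s"
    and win: "\<And>r'. r' \<in> pverts G \<Longrightarrow> h r' \<le> s \<Longrightarrow> win_within G t c' r'"
  shows "win_within G (Suc t) c r"
proof -
  have "win_within G t c' r'" if "robber_move G c' r r'" for r'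
  proof -
    have "r' \<in> {v \<in> pverts G. h v \<le> s}"
    proof (rule robber_move_stays_in_closed_set[OF that])
      show "r \<in> {v \<in> pverts G. h v \<le> s}" using r by simp
    next
      fix u v assume uv: "(u, v) \<in> unguarded_arcs G c'" and u: "u \<in> {v \<in> pverts G. h v \<le> s}"
      then have "h u \<noteq> s" using cov by (auto simp: unguarded_arcs_def)
      with uv u lip[of u v] wf show "v \<in> {v \<in> pverts G. h v \<le> s}"
        by (auto simp: unguarded_arcs_def)
    qed
    then show ?thesis by (intro win) auto
  qed
  with move show ?thesis by auto
qed

text \<open>
  The common shape of all sweeps. The map \<open>g\<close> says how the guards of a level step down so that they
  occupy the next lower level completely; \<open>S\<close> bounds the levels on which this is possible. Guards
  whose step along \<open>g\<close> is not an arc just wait. The barrier descends until it reaches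
  level \<open>0\<close>.
\<close>

lemma layered_sweep:
  fixes h :: "'a \<Rightarrow> nat"
  assumes wf: "parcs G \<subseteq> pverts G \<times> pverts G"
    and lip: "\<And>u v. (u, v) \<in> parcs G \<Longrightarrow> h v \<le> Suc (h u)"
    and pull: "\<And>w. w \<in> pverts G \<Longrightarrow> h w < S \<Longrightarrow> \<exists>u. (u, w) \<in> parcs G \<and> h u = Suc (h w) \<and> g u = w"
    and "s \<le> S" "{v \<in> pverts G. h v = s} \<subseteq> set c" "r \<in> pverts G" "h r \<le> s"
  shows "win_within G s c r"
  using assms(4-)
proof (induction s arbitrary: c r)
  case (Suc s)
  show ?case
  proof (cases "h r = Suc s")
    case True
    then have "win_within G 0 c r" using Suc.prems by auto
    then show ?thesis by (rule win_within_mono) simp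
  next
    case False
    define c' where "c' = map (\<lambda>u. if (u, g u) \<in> parcs G then g u else u) c"
    have move: "cop_move G c c'"
      by (auto simp: cop_move_def c'_def list_all2_conv_all_nth)
    have cov: "{v \<in> pverts G. h v = s} \<subseteq> set c'"
    proof
      fix w assume w: "w \<in> {v \<in> pverts G. h v = s}"
      then obtain u where u: "(u, w) \<in> parcs G" "h u = Suc s" "g u = w"
        using pull[of w] Suc.prems(1) by auto
      then have "u \<in> set c" using Suc.prems(2) wf by auto
      then show "w \<in> set c'" using u unfolding c'_def set_map by (intro image_eqI[of _ _ u]) auto
    qed
    show ?thesis
      by (rule win_within_behind_barrier[OF wf lip move cov])
        (use Suc False cov in auto)
  qed
qed auto

text \<open>
  A full row of cops marches across the grid.
\<close>

lemma cops_win_grid_sweep: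
  assumes "n \<ge> 1"
  shows "cops_win (grid n) n"
proof (rule cops_win_if_win_within)
  let ?c = "map (\<lambda>y. (0, y)) [0..<n]"
  show "?c \<in> cop_positions (grid n) n"
    using assms by (auto simp: cop_positions_def verts_grid)
  fix r assume r: "r \<in> pverts (grid n)"
  show "win_within (grid n) (n - 1) ?c r"
  proof (rule layered_sweep[OF wf_grid, where h = "\<lambda>(x, y). n - 1 - x" and g = "\<lambda>(x, y). (Suc x, y)"
        and S = "n - 1"])
    fix w assume "w \<in> pverts (grid n)" "(case w of (x, y) \<Rightarrow> n - 1 - x) < n - 1"
    then show "\<exists>u. (u, w) \<in> parcs (grid n) \<and>
        (case u of (x, y) \<Rightarrow> n - 1 - x) = Suc (case w of (x, y) \<Rightarrow> n - 1 - x) \<and>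
        (case u of (x, y) \<Rightarrow> (Suc x, y)) = w"
      by (intro exI[of _ "(fst w - 1, snd w)"]) (auto simp: verts_grid arcs_grid_iff)
  qed (use r in \<open>auto simp: verts_grid arcs_grid_iff\<close>)
qed

text \<open>
  A guarded antidiagonal shrinks into the corner by a step of its guards along the first coordinate;
  the guard for whom this coordinate is \<open>0\<close> is dispensable and waits.
\<close>

lemma upper_corner_sweep:
  assumes "s < n" "{v \<in> pverts (grid n). fst v + snd v = s} \<subseteq> set c"
    "r \<in> pverts (grid n)" "fst r + snd r \<le> s"
  shows "win_within (grid n) s c r"
proof (rule layered_sweep[OF wf_grid, where h = "\<lambda>v. fst v + snd v" and S = "n - 1"
      and g = "\<lambda>v. (fst v - 1, snd v)"])
  fix w assume "w \<in> pverts (grid n)" "fst w + snd w < n - 1"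
  then show "\<exists>u. (u, w) \<in> parcs (grid n) \<and> fst u + snd u = Suc (fst w + snd w) \<and>
      (fst u - 1, snd u) = w"
    by (intro exI[of _ "(Suc (fst w), snd w)"]) (auto simp: verts_grid arcs_grid_iff)
qed (use assms in \<open>auto simp: arcs_grid_iff\<close>)

lemma lower_corner_sweep:
  assumes "s < n" "{v \<in> pverts (grid n). (n - 1 - fst v) + (n - 1 - snd v) = s} \<subseteq> set c"
    "r \<in> pverts (grid n)" "(n - 1 - fst r) + (n - 1 - snd r) \<le> s"
  shows "win_within (grid n) s c r"
proof (rule layered_sweep[OF wf_grid, where h = "\<lambda>v. (n - 1 - fst v) + (n - 1 - snd v)"
      and S = "n - 1" and g = "\<lambda>v. (Suc (fst v), snd v)"])
  fix w assume "w \<in> pverts (grid n)" "(n - 1 - fst w) + (n - 1 - snd w) < n - 1"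
  then show "\<exists>u. (u, w) \<in> parcs (grid n) \<and>
      (n - 1 - fst u) + (n - 1 - snd u) = Suc ((n - 1 - fst w) + (n - 1 - snd w)) \<and>
      (Suc (fst u), snd u) = w"
    by (intro exI[of _ "(fst w - 1, snd w)"]) (auto simp: verts_grid arcs_grid_iff)
qed (use assms in \<open>auto simp: arcs_grid_iff\<close>)

text \<open>
  Two cops start on each odd vertex of the main antidiagonal \<open>x + y = 2 * m\<close>. Each pair can step to
  two consecutive vertices of either neighbouring antidiagonal, which is then guarded completely by
  the \<open>2 * m\<close> cops. So a robber off the main antidiagonal is shut into a corner and swept. A robber on
  an even vertex of the main antidiagonal has his neighbours among the places that the at most two
  adjacent pairs can reach, and these pairs enclose him there.
\<close>

lemma cops_win_odd_grid:
  assumes "m \<ge> 1"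
  shows "cops_win (grid (2 * m + 1)) (2 * m)"
proof (rule cops_win_if_win_within)
  let ?n = "2 * m + 1"
  let ?G = "grid ?n"
  \<comment> \<open>The cops \<open>2 * i\<close> and \<open>2 * i + 1\<close> form the pair at the vertex with first coordinate \<open>2 * i + 1\<close>.\<close>
  define odd_up :: "nat \<Rightarrow> nat" where "odd_up e = (if even e then Suc e else e)" for e
  define c where "c = map (\<lambda>e. (odd_up e, 2 * m - odd_up e)) [0..<2 * m]"
  have up: "odd_up e < 2 * m" if "e < 2 * m" for e
    using that unfolding odd_up_def by presburger
  show "c \<in> cop_positions ?G (2 * m)"
    using up by (fastforce simp: c_def cop_positions_def verts_grid)
  have move: "cop_move ?G c (map f [0..<2 * m])"
    if "\<And>e. e < 2 * m \<Longrightarrow> f e = (odd_up e, 2 * m - odd_up e) \<or>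
      ((odd_up e, 2 * m - odd_up e), f e) \<in> parcs ?G" for f
    using that by (auto simp: cop_move_def c_def list_all2_conv_all_nth)
  fix r assume r: "r \<in> pverts ?G"
  obtain x y where xy: "r = (x, y)" by force
  then have lt: "x \<le> 2 * m" "y \<le> 2 * m" using r by (auto simp: verts_grid)
  consider "x + y < 2 * m" | "x + y > 2 * m" | "x + y = 2 * m" "odd x" | "x + y = 2 * m" "even x"
    by linarith
  then show "win_within ?G (2 * m) c r"
  proof cases
    case 1
    let ?c' = "map (\<lambda>e. (e, 2 * m - 1 - e)) [0..<2 * m]"
    have mv: "cop_move ?G c ?c'"
      by (rule move) (auto simp: odd_up_def arcs_grid_iff)
    have cov: "{v \<in> pverts ?G. fst v + snd v = 2 * m - 1} \<subseteq> set ?c'"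
      using assms by (auto simp: image_iff)
    have "win_within ?G (Suc (2 * m - 1)) c r"
      by (rule win_within_behind_barrier[OF wf_grid _ mv cov])
        (use 1 xy r assms upper_corner_sweep[OF _ cov] in \<open>auto simp: arcs_grid_iff\<close>)
    then show ?thesis using assms by simp
  next
    case 2
    let ?c' = "map (\<lambda>e. (Suc e, 2 * m - e)) [0..<2 * m]"
    let ?h = "\<lambda>v. (?n - 1 - fst v) + (?n - 1 - snd v)"
    have mv: "cop_move ?G c ?c'"
      by (rule move) (auto simp: odd_up_def arcs_grid_iff)
    have cov: "{v \<in> pverts ?G. ?h v = 2 * m - 1} \<subseteq> set ?c'"
    proof
      fix v assume "v \<in> {v \<in> pverts ?G. ?h v = 2 * m - 1}"
      then show "v \<in> set ?c'" using assms
        by (auto simp: verts_grid image_iff intro!: bexI[of _ "fst v - 1"])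
    qed
    have "win_within ?G (Suc (2 * m - 1)) c r"
      by (rule win_within_behind_barrier[OF wf_grid _ mv cov])
        (use 2 xy r lt assms lower_corner_sweep[OF _ cov] in \<open>auto simp: arcs_grid_iff\<close>)
    then show ?thesis using assms by simp
  next
    case 3
    then have "r \<in> set c" using xy lt
      by (auto simp: c_def odd_up_def image_iff intro!: bexI[of _ x]) presburger
    then have "win_within ?G 0 c r" by simp
    then show ?thesis by (rule win_within_mono) simp
  next
    case 4
    \<comment> \<open>The cops \<open>x\<close> and \<open>x + 1\<close> come from the pair on one side of the robber, \<open>x - 1\<close> and \<open>x - 2\<close>
      from the pair on the other side; at a corner only one of the pairs exists.\<close>
    define f where "f e = (if e = x then (x, y - 1) else if e = Suc x then (Suc x, y)
      else if Suc e = x then (x - 1, y) else if Suc (Suc e) = x then (x, Suc y)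
      else (odd_up e, 2 * m - odd_up e))" for e
    let ?c' = "map f [0..<2 * m]"
    have mv: "cop_move ?G c ?c'"
      by (rule move) (use 4 in \<open>auto simp: f_def odd_up_def arcs_grid_iff\<close>)
    have nbr: "v \<in> set ?c'" if "(r, v) \<in> parcs ?G" for v
    proof -
      obtain p q where v: "v = (p, q)" by force
      from that have "p \<le> 2 * m \<and> q \<le> 2 * m \<and> (p = x \<and> (q = Suc y \<or> y = Suc q) \<or>
          q = y \<and> (p = Suc x \<or> x = Suc p))"
        by (auto simp: v xy arcs_grid_iff)
      then consider "v = (x, y - 1)" "y \<ge> 1" | "v = (Suc x, y)" "x < 2 * m"
        | "v = (x - 1, y)" "x \<ge> 1" | "v = (x, Suc y)" "y < 2 * m"
        using v by fastforce
      then obtain e where "e < 2 * m" "f e = v"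
      proof cases
        case 1 then show ?thesis using 4 that[of x] by (auto simp: f_def)
      next
        case 2
        then have "Suc x < 2 * m" using 4 by presburger
        then show ?thesis using 2 that[of "Suc x"] by (auto simp: f_def)
      next
        case 3 then show ?thesis using 4 lt that[of "x - 1"] by (cases x) (auto simp: f_def)
      next
        case 5: 4
        then have "2 \<le> x" using 4 by presburger
        then show ?thesis using 5 4 that[of "x - 2"] by (auto simp: f_def)
      qed
      then show ?thesis by auto
    qed
    have "win_within ?G 1 ?c' r'" if rm: "robber_move ?G ?c' r r'" for r'
    proof -
      have "r' \<in> {r}"
        by (rule robber_move_stays_in_closed_set[OF rm])
          (use nbr in \<open>auto simp: unguarded_arcs_def simp del: set_map\<close>)
      define v where "v = (if x = 0 then (Suc x, y) else (x - 1, y))"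
      have arc: "(r, v) \<in> parcs ?G" "(v, r) \<in> parcs ?G"
        using lt assms by (auto simp: v_def xy arcs_grid_iff)
      show ?thesis using win_within_adjacent[OF nbr[OF arc(1)] arc(2)] \<open>r' \<in> {r}\<close> by simp
    qed
    with mv have "win_within ?G (Suc 1) c r" unfolding win_within.simps(2) by blast
    then show ?thesis by (rule win_within_mono) (use assms in simp)
  qed
qed

section \<open>The infinite-speed cop number of square grids\<close>

theorem theorem2p4:
  fixes n :: nat
  assumes "n \<ge> 1"
  shows "(n \<le> 2 \<longrightarrow> c\<^sub>\<infinity> (path_graph n \<box> path_graph n) = n) \<and>
         (odd n \<and> n \<ge> 3 \<longrightarrow> c\<^sub>\<infinity> (path_graph n \<box> path_graph n) = n - 1) \<and>
         (even n \<and> n \<ge> 4 \<longrightarrow> c\<^sub>\<infinity> (path_graph n \<box> path_graph n) \<in> {n - 1, n})"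
proof -
  let ?k = "c\<^sub>\<infinity> (grid n)"
  have attained: "cops_win (grid n) ?k"
    by (rule cops_win_cop_number_inf) (simp add: verts_grid)
  have lower: "n - 1 \<le> ?k" using not_cops_win_grid[of ?k n] attained by fastforce
  have upper: "?k \<le> n"
    unfolding cop_number_inf_def using cops_win_grid_sweep[OF assms] by (rule Least_le)
  have small: "?k = n" if "n \<le> 2"
  proof -
    have "?k \<noteq> 0" using not_cops_win_without_cops[OF assms] attained by metis
    moreover have "?k \<noteq> 1" if "n = 2" using not_cops_win_four_cycle attained that by metis
    ultimately show ?thesis using upper that by linarith
  qed
  have odd: "?k = n - 1" if n: "odd n" "n \<ge> 3"
  proof -
    obtain m where m: "n = 2 * m + 1" using n(1) by (rule oddE)
    then have "cops_win (grid n) (n - 1)" using cops_win_odd_grid[of m] n(2) by simp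
    then have "?k \<le> n - 1" unfolding cop_number_inf_def by (rule Least_le)
    then show ?thesis using lower by simp
  qed
  show ?thesis using small odd lower upper by auto
qed

end
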